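(* Let $\tau$ be a topology on a lattice $L$. Then the following conditions are equivalent: (1) for every net $(x_\gamma)$ in $L$ and every $x\in L$, if $(x_\gamma)$ $\mathfrak{u}O_1$-converges to $x$, then $(x_\gamma)$ converges to $x$ with respect to $\tau$; (2) for every net $(x_\gamma)$ in $L$ and every $x\in L$, if $(x_\gamma)$ $\mathfrak{u}O_2$-converges to $x$, then $(x_\gamma)$ converges to $x$ with respect to $\tau$.
   Context: In a lattice $L$, a subset is directed if it is nonempty and each of its finite subsets has an upper bound in it; filtered is the dual notion. $[a,b]:=\{x: a\le x\le b\}$. A property holds eventually for a net $(x_\gamma)_{\gamma\in\Gamma}$ if there is $\gamma_0$ such that it holds for $(x_\gamma)_{\gamma\ge\gamma_0}$. $x_\gamma\uparrow x$ means the net is increasing with supremum $x$; $x_\gamma\downarrow x$ means it is decreasing with infimum $x$. $(x_\gamma)_{\gamma\in\Gamma}$ $O_1$-converges to $x$ if there are nets $(y_\gamma)_{\gamma\in\Gamma}$, $(z_\gamma)_{\gamma\in\Gamma}$ in $L$ (same index set) such that $y_\gamma\uparrow x$, $z_\gamma\downarrow x$ and eventually $y_\gamma\le x_\gamma\le z_\gamma$. $(x_\gamma)_{\gamma\in\Gamma}$ $O_2$-converges to $x$ if there are a directed $M\subseteq L$ and a filtered $N\subseteq L$ with $\sup M=\inf N=x$ such that for every $(m,n)\in M\times N$ the net is eventually contained in $[m,n]$. For $s,t\in L$ let $f_{s,t}:L\to L$, $f_{s,t}(x):=(x\wedge t)\vee s$. For $i\in\{1,2\}$, $(x_\gamma)$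 $\mathfrak{u}O_i$-converges to $x$ if $(f_{s,t}(x_\gamma))$ $O_i$-converges to $f_{s,t}(x)$ for all $s,t\in L$ with $s\le t$. *)

theory Defs
  imports "HOL-Analysis.Abstract_Limits" "HOL-Library.Lub_Glb"
begin

definition directed_wrt :: "('b \<Rightarrow> 'b \<Rightarrow> bool) \<Rightarrow> 'b set \<Rightarrow> bool" where
  "directed_wrt r D \<longleftrightarrow>
     D \<noteq> {} \<and> (\<forall>F. finite F \<and> F \<subseteq> D \<longrightarrow> (\<exists>u\<in>D. \<forall>d\<in>F. r d u))"

text \<open>A net is a function on an index set \<open>I\<close> that is preordered and directed by a relation \<open>r\<close>,
  where \<open>r i j\<close> reads "\<open>i\<close> is below \<open>j\<close>". Neither the values of the function nor the
  relation outside \<open>I\<close> play any role.\<close>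

definition net_index :: "'i set \<Rightarrow> ('i \<Rightarrow> 'i \<Rightarrow> bool) \<Rightarrow> bool" where
  "net_index I r \<longleftrightarrow> reflp_on I r \<and> transp_on I r \<and> directed_wrt r I"

definition tails :: "'i set \<Rightarrow> ('i \<Rightarrow> 'i \<Rightarrow> bool) \<Rightarrow> 'i filter" where
  "tails I r = (INF i\<in>I. principal {j\<in>I. r i j})"

lemma eventually_tails:
  assumes "net_index I r"
  shows "eventually P (tails I r) \<longleftrightarrow> (\<exists>i\<in>I. \<forall>j\<in>I. r i j \<longrightarrow> P j)"
proof -
  have ne: "I \<noteq> {}" and tr: "transp_on I r"
    using assms by (auto simp: net_index_def directed_wrt_def)
  have "\<exists>k\<in>I. principal {l\<in>I. r k l} \<le> inf (principal {l\<in>I. r i l}) (principal {l\<in>I. r j l})"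
    if ij: "i \<in> I" "j \<in> I" for i j
  proof -
    have "finite {i, j} \<and> {i, j} \<subseteq> I" using ij by simp
    then obtain k where k: "k \<in> I" "r i k" "r j k"
      using assms unfolding net_index_def directed_wrt_def by (metis insertCI)
    show ?thesis
      using k ij by (intro bexI[of _ k]) (auto intro: transp_onD[OF tr])
  qed
  then show ?thesis
    unfolding tails_def using ne
    by (subst eventually_INF_base) (auto simp: eventually_principal)
qed

definition O1_converges ::
  "'i set \<Rightarrow> ('i \<Rightarrow> 'i \<Rightarrow> bool) \<Rightarrow> ('i \<Rightarrow> 'a::lattice) \<Rightarrow> 'a \<Rightarrow> bool" where
  "O1_converges I r x a \<longleftrightarrow>
     (\<exists>y z. monotone_on I r (\<le>) y \<and> isLub UNIV (y ` I) a \<and>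
            monotone_on I r (\<ge>) z \<and> isGlb UNIV (z ` I) a \<and>
            (\<forall>\<^sub>F i in tails I r. y i \<le> x i \<and> x i \<le> z i))"

definition O2_converges ::
  "'i set \<Rightarrow> ('i \<Rightarrow> 'i \<Rightarrow> bool) \<Rightarrow> ('i \<Rightarrow> 'a::lattice) \<Rightarrow> 'a \<Rightarrow> bool" where
  "O2_converges I r x a \<longleftrightarrow>
     (\<exists>M N. directed_wrt (\<le>) M \<and> isLub UNIV M a \<and>
            directed_wrt (\<ge>) N \<and> isGlb UNIV N a \<and>
            (\<forall>m\<in>M. \<forall>n\<in>N. \<forall>\<^sub>F i in tails I r. x i \<in> {m..n}))"

definition trunc :: "'a::lattice \<Rightarrow> 'a \<Rightarrow> 'a \<Rightarrow> 'a" where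
  "trunc s t x = sup (inf x t) s"

definition uO1_converges ::
  "'i set \<Rightarrow> ('i \<Rightarrow> 'i \<Rightarrow> bool) \<Rightarrow> ('i \<Rightarrow> 'a::lattice) \<Rightarrow> 'a \<Rightarrow> bool" where
  "uO1_converges I r x a \<longleftrightarrow>
     (\<forall>s t. s \<le> t \<longrightarrow> O1_converges I r (\<lambda>i. trunc s t (x i)) (trunc s t a))"

definition uO2_converges ::
  "'i set \<Rightarrow> ('i \<Rightarrow> 'i \<Rightarrow> bool) \<Rightarrow> ('i \<Rightarrow> 'a::lattice) \<Rightarrow> 'a \<Rightarrow> bool" where
  "uO2_converges I r x a \<longleftrightarrow>
     (\<forall>s t. s \<le> t \<longrightarrow> O2_converges I r (\<lambda>i. trunc s t (x i)) (trunc s t a))"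

text \<open>The argument of type \<open>'i itself\<close> fixes the type from which index sets are taken:
  a quantifier over nets can only range over index sets in one given type.\<close>

definition uO1_implies_convergence :: "'i itself \<Rightarrow> 'a::lattice topology \<Rightarrow> bool" where
  "uO1_implies_convergence _ T \<longleftrightarrow>
     (\<forall>(I :: 'i set) r x a. net_index I r \<and> uO1_converges I r x a \<longrightarrow>
        limitin T x a (tails I r))"

definition uO2_implies_convergence :: "'i itself \<Rightarrow> 'a::lattice topology \<Rightarrow> bool" where
  "uO2_implies_convergence _ T \<longleftrightarrow>
     (\<forall>(I :: 'i set) r x a. net_index I r \<and> uO2_converges I r x a \<longrightarrow>
        limitin T x a (tails I r))"

text \<open>A type of indices large enough to represent all nets in \<open>'a\<close> as far as the two conditions
  are concerned. The last two components suffice to realise the tail filter of any net (by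
  pairs \<open>(A, a)\<close> with \<open>a \<in> A\<close> and \<open>A\<close> in the filter); the first two leave room for choosing, for
  each pair \<open>(s, t)\<close>, a lower and an upper bound, and for a finite set of such pairs.\<close>

type_synonym 'a universal_index =
  "('a \<times> 'a \<Rightarrow> 'a \<times> 'a) \<times> ('a \<times> 'a) set \<times> 'a set \<times> 'a"

end

theory Submission
  imports Defs
begin

text \<open>A monotone net of bounds is in particular a directed set of bounds, so \<open>uO\<^sub>1\<close>-convergence
  implies \<open>uO\<^sub>2\<close>-convergence of the same net. Conversely, let \<open>x\<close> be \<open>uO\<^sub>2\<close>-convergent to \<open>a\<close>, with
  sets of bounds \<open>M p\<close> and \<open>N p\<close> for each pair \<open>p = (s, t)\<close>. Consider quadruples
  \<open>(\<phi>, F, A, b)\<close>, where \<open>\<phi>\<close> selects an element of \<open>M p \<times> N p\<close> for every \<open>p\<close>, the set \<open>F\<close> of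
  pairs is finite, \<open>x\<close> is eventually in \<open>A\<close>, \<open>b \<in> A\<close>, and \<open>A\<close> is so small that for \<open>p \<in> F\<close> the
  truncations of its elements lie between the two bounds \<open>\<phi> p\<close>. The net \<open>(\<phi>, F, A, b) \<mapsto> b\<close> is
  \<open>uO\<^sub>1\<close>-convergent to \<open>a\<close>, the components of \<open>\<phi> p\<close> being the monotone bounds for \<open>p\<close>.
  It is eventually in a set \<open>U\<close> only if some \<open>A\<close> is contained in \<open>U\<close>, hence only if \<open>x\<close> is
  eventually in \<open>U\<close>.\<close>

lemma directed_wrtI:
  assumes "D \<noteq> {}" and trans: "transp_on D r"
    and ub: "\<And>a b. a \<in> D \<Longrightarrow> b \<in> D \<Longrightarrow> \<exists>c\<in>D. r a c \<and> r b c"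
  shows "directed_wrt r D"
  unfolding directed_wrt_def
proof (intro conjI allI impI)
  show "\<exists>u\<in>D. \<forall>d\<in>F. r d u" if "finite F \<and> F \<subseteq> D" for F
    using that[THEN conjunct1] that[THEN conjunct2]
  proof (induction F)
    case empty
    then show ?case using assms(1) by auto
  next
    case (insert d F)
    then obtain u where u: "u \<in> D" "\<forall>e\<in>F. r e u" by auto
    moreover obtain v where "v \<in> D" "r d v" "r u v"
      using ub[of d u] u insert.prems by auto
    ultimately show ?case
      using insert.prems trans by (auto intro!: bexI[of _ v] dest: transp_onD)
  qed
qed (fact assms(1))

lemma directed_wrt_ub2:
  assumes "directed_wrt r D" "a \<in> D" "b \<in> D"
  shows "\<exists>c\<in>D. r a c \<and> r b c"
  using assms(1)[unfolded directed_wrt_def, THEN conjunct2, rule_format, of "{a, b}"] assms(2,3)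
  by auto

lemma tails_neq_bot: "net_index I r \<Longrightarrow> tails I r \<noteq> bot"
  unfolding trivial_limit_def
  by (auto simp: eventually_tails net_index_def dest: reflp_onD)

lemma eventually_tails_above:
  assumes "net_index I r" "i \<in> I"
  shows "\<forall>\<^sub>F j in tails I r. j \<in> I \<and> r i j"
  using assms by (auto simp: eventually_tails)

lemma directed_wrt_image:
  assumes "net_index I r" "monotone_on I r ord y" "transp ord"
  shows "directed_wrt ord (y ` I)"
proof (rule directed_wrtI)
  show "y ` I \<noteq> {}" using assms(1) by (auto simp: net_index_def directed_wrt_def)
  show "transp_on (y ` I) ord" using assms(3) by (rule transp_on_subset) simp
next
  fix a b assume "a \<in> y ` I" "b \<in> y ` I"
  then obtain i j where ij: "i \<in> I" "a = y i" "j \<in> I" "b = y j" by auto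
  then obtain k where "k \<in> I" "r i k" "r j k"
    using assms(1) directed_wrt_ub2[of r I i j] by (auto simp: net_index_def)
  then show "\<exists>c\<in>y ` I. ord a c \<and> ord b c"
    using ij assms(2) by (auto dest: monotone_onD)
qed

lemma O1_converges_imp_O2_converges:
  assumes I: "net_index I r" and "O1_converges I r x a"
  shows "O2_converges I r x a"
proof -
  obtain y z where y: "monotone_on I r (\<le>) y" "isLub UNIV (y ` I) a"
    and z: "monotone_on I r (\<ge>) z" "isGlb UNIV (z ` I) a"
    and ev: "\<forall>\<^sub>F i in tails I r. y i \<le> x i \<and> x i \<le> z i"
    using assms(2) unfolding O1_converges_def by blast
  \<comment> \<open>Once \<open>k\<close> is beyond both \<open>i\<close> and \<open>j\<close>,
    monotonicity widens the bounds \<open>y k\<close>, \<open>z k\<close> to \<open>y i\<close>,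
    \<open>z j\<close>.\<close>
  have "\<forall>\<^sub>F k in tails I r. x k \<in> {y i..z j}" if "i \<in> I" "j \<in> I" for i j
    using ev eventually_tails_above[OF I that(1)] eventually_tails_above[OF I that(2)]
  proof eventually_elim
    case (elim k)
    then have "y i \<le> y k" "z k \<le> z j"
      using that by (auto intro: monotone_onD[OF y(1)] monotone_onD[OF z(1)])
    with elim show ?case by (auto intro: order_trans)
  qed
  then show ?thesis
    unfolding O2_converges_def using y z
    by (intro exI[of _ "y ` I"] exI[of _ "z ` I"])
       (auto intro!: directed_wrt_image[OF I] transpI intro: order_trans)
qed

lemma uO1_converges_imp_uO2_converges:
  "net_index I r \<Longrightarrow> uO1_converges I r x a \<Longrightarrow> uO2_converges I r x a"
  by (auto simp: uO1_converges_def uO2_converges_def intro: O1_converges_imp_O2_converges)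

text \<open>Carries limits of \<open>y\<close> in any topology back to \<open>x\<close>; the new
  index type depends on \<open>'a\<close> alone, not on \<open>'i\<close>.\<close>

lemma uO2_converges_refine:
  fixes x :: "'i \<Rightarrow> 'a::lattice"
  assumes I: "net_index I r" and conv: "uO2_converges I r x a"
  obtains J :: "'a universal_index set" and s y
  where "net_index J s" "uO1_converges J s y a"
    "\<And>P. \<forall>\<^sub>F j in tails J s. P (y j) \<Longrightarrow> \<forall>\<^sub>F i in tails I r. P (x i)"
proof -
  txt \<open>Replacing \<open>s\<close> by \<open>inf s t\<close> makes bounds available for all pairs, ordered or not.\<close>
  define f where "f p = trunc (inf (fst p) (snd p)) (snd p)" for p :: "'a \<times> 'a"
  have "\<forall>p. O2_converges I r (\<lambda>i. f p (x i)) (f p a)"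
    using conv by (simp add: uO2_converges_def f_def)
  then obtain M N where
    M: "\<And>p. directed_wrt (\<le>) (M p)" "\<And>p. isLub UNIV (M p) (f p a)" and
    N: "\<And>p. directed_wrt (\<ge>) (N p)" "\<And>p. isGlb UNIV (N p) (f p a)" and
    MN: "\<And>p m n. m \<in> M p \<Longrightarrow> n \<in> N p \<Longrightarrow> \<forall>\<^sub>F i in tails I r. f p (x i) \<in> {m..n}"
    unfolding O2_converges_def by metis
  define sel where "sel = {\<phi>. \<forall>p. \<phi> p \<in> M p \<times> N p}"
  define J where "J = {(\<phi>, F, A, b). \<phi> \<in> sel \<and> finite F \<and> (\<forall>\<^sub>F i in tails I r. x i \<in> A) \<and>
    b \<in> A \<and> (\<forall>p\<in>F. \<forall>c\<in>A. f p c \<in> {fst (\<phi> p)..snd (\<phi> p)})}"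
  \<comment> \<open>The last component is ignored, so indices in \<open>J\<close> that differ only
    there lie above each other.\<close>
  define s :: "'a universal_index \<Rightarrow> 'a universal_index \<Rightarrow> bool" where
    "s = (\<lambda>(\<phi>, F, A, b) (\<psi>, G, B, c).
       (\<forall>p. fst (\<phi> p) \<le> fst (\<psi> p) \<and> snd (\<psi> p) \<le> snd (\<phi> p)) \<and> F \<subseteq> G \<and> B \<subseteq> A)"
  define y :: "'a universal_index \<Rightarrow> 'a" where "y = (\<lambda>(\<phi>, F, A, b). b)"
  define lo :: "'a \<times> 'a \<Rightarrow> 'a universal_index \<Rightarrow> 'a" where "lo p = (\<lambda>(\<phi>, _). fst (\<phi> p))" for p
  define hi :: "'a \<times> 'a \<Rightarrow> 'a universal_index \<Rightarrow> 'a" where "hi p = (\<lambda>(\<phi>, _). snd (\<phi> p))" for p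

  note split_paired_All [simp del]
  \<comment> \<open>Cut \<open>A\<close> down by the finitely many conditions from \<open>F\<close>:
    \<open>x\<close> is still eventually inside, and the result is nonempty because the tail filter
    is proper.\<close>
  have extend: "\<exists>B b. (\<phi>, F, B, b) \<in> J \<and> B \<subseteq> A"
    if "\<phi> \<in> sel" "finite F" "\<forall>\<^sub>F i in tails I r. x i \<in> A" for \<phi> F A
  proof -
    define B where "B = {c\<in>A. \<forall>p\<in>F. f p c \<in> {fst (\<phi> p)..snd (\<phi> p)}}"
    have "\<forall>\<^sub>F i in tails I r. \<forall>p\<in>F. f p (x i) \<in> {fst (\<phi> p)..snd (\<phi> p)}"
      using that(1) by (intro eventually_ball_finite that(2) ballI MN) (auto simp: sel_def mem_Times_iff)
    with that(3) have B: "\<forall>\<^sub>F i in tails I r. x i \<in> B"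
      by eventually_elim (simp add: B_def)
    then obtain b where "b \<in> B"
      using eventually_happens'[OF tails_neq_bot[OF I]] by blast
    with that B have "(\<phi>, F, B, b) \<in> J" by (auto simp: J_def B_def)
    then show ?thesis by (auto simp: B_def)
  qed

  have "\<And>p. M p \<noteq> {}" "\<And>p. N p \<noteq> {}"
    using M(1) N(1) by (auto simp: directed_wrt_def)
  then have "(\<lambda>p. (SOME m. m \<in> M p, SOME n. n \<in> N p)) \<in> sel"
    by (simp add: sel_def some_in_eq)
  then obtain \<phi>0 where \<phi>0: "\<phi>0 \<in> sel" ..
  have sel_point: "\<exists>\<phi>\<in>sel. \<phi> p = (m, n)" if "m \<in> M p" "n \<in> N p" for p m n
    using that \<phi>0 by (intro bexI[of _ "\<phi>0(p := (m, n))"]) (auto simp: sel_def)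
  \<comment> \<open>With \<open>F = {}\<close> every selector extends to an index, so
    \<open>lo p\<close> and \<open>hi p\<close> have the full ranges \<open>M p\<close> and
    \<open>N p\<close> and inherit their supremum and infimum.\<close>
  have J_point: "\<exists>j\<in>J. lo p j = m \<and> hi p j = n" if "m \<in> M p" "n \<in> N p" for p m n
  proof -
    obtain \<phi> where \<phi>: "\<phi> \<in> sel" "\<phi> p = (m, n)" using sel_point \<open>m \<in> M p\<close> \<open>n \<in> N p\<close> by blast
    then obtain B b where "(\<phi>, {}, B, b) \<in> J" using extend[of \<phi> "{}" UNIV] by auto
    with \<phi> show ?thesis by (intro bexI[of _ "(\<phi>, {}, B, b)"]) (auto simp: lo_def hi_def)
  qed
  have lo_image: "lo p ` J = M p" and hi_image: "hi p ` J = N p" for p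
  proof -
    have "lo p ` J \<subseteq> M p" "hi p ` J \<subseteq> N p"
      by (auto simp: lo_def hi_def J_def sel_def mem_Times_iff)
    moreover obtain m0 n0 where "m0 \<in> M p" "n0 \<in> N p"
      using \<open>M p \<noteq> {}\<close> \<open>N p \<noteq> {}\<close> by blast
    then have "M p \<subseteq> lo p ` J" "N p \<subseteq> hi p ` J"
      using J_point[of _ p n0] J_point[of m0 p] by (fastforce simp: image_iff)+
    ultimately show "lo p ` J = M p" "hi p ` J = N p" by auto
  qed

  have trans: "transp_on J s"
  proof (rule transp_onI)
    fix j k l assume "s j k" "s k l"
    then show "s j l"
      unfolding s_def split_def by (meson order_trans)
  qed
  have net: "net_index J s"
    unfolding net_index_def
  proof (intro conjI directed_wrtI)
    show "reflp_on J s" by (auto simp: reflp_on_def s_def)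
    show "J \<noteq> {}" using extend[of \<phi>0 "{}" UNIV] \<phi>0 by auto
    show "\<exists>l\<in>J. s j l \<and> s k l" if "j \<in> J" "k \<in> J" for j k
    proof -
      obtain \<phi> F A b where j: "j = (\<phi>, F, A, b)" by (cases j)
      obtain \<psi> G B c where k: "k = (\<psi>, G, B, c)" by (cases k)
      have mem: "\<phi> p \<in> M p \<times> N p" "\<psi> p \<in> M p \<times> N p" for p
        using that by (auto simp: j k J_def sel_def)
      \<comment> \<open>Common bounds exist for each \<open>p\<close> separately; choice assembles
        them into one selector.\<close>
      have "\<exists>q. q \<in> M p \<times> N p \<and> fst (\<phi> p) \<le> fst q \<and> fst (\<psi> p) \<le> fst q \<and>
          snd q \<le> snd (\<phi> p) \<and> snd q \<le> snd (\<psi> p)" for p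
        using directed_wrt_ub2[OF M(1)[of p], of "fst (\<phi> p)" "fst (\<psi> p)"]
          directed_wrt_ub2[OF N(1)[of p], of "snd (\<phi> p)" "snd (\<psi> p)"] mem[of p]
        by (auto simp: mem_Times_iff)
      then obtain \<chi> where \<chi>: "\<And>p. \<chi> p \<in> M p \<times> N p \<and> fst (\<phi> p) \<le> fst (\<chi> p) \<and>
          fst (\<psi> p) \<le> fst (\<chi> p) \<and> snd (\<chi> p) \<le> snd (\<phi> p) \<and> snd (\<chi> p) \<le> snd (\<psi> p)"
        by metis
      have "\<forall>\<^sub>F i in tails I r. x i \<in> A \<inter> B" "finite (F \<union> G)" "\<chi> \<in> sel"
        using that \<chi> by (auto simp: j k J_def sel_def eventually_conj_iff)
      then obtain C d where "(\<chi>, F \<union> G, C, d) \<in> J" "C \<subseteq> A \<inter> B"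
        using extend by blast
      then show ?thesis
        using \<chi> by (intro bexI[of _ "(\<chi>, F \<union> G, C, d)"]) (auto simp: j k s_def)
    qed
  qed (fact trans)+

  have "O1_converges J s (\<lambda>j. f p (y j)) (f p a)" for p
    unfolding O1_converges_def
  proof (intro exI conjI)
    show "monotone_on J s (\<le>) (lo p)" "monotone_on J s (\<ge>) (hi p)"
      by (auto simp: monotone_on_def lo_def hi_def s_def)
    show "isLub UNIV (lo p ` J) (f p a)" "isGlb UNIV (hi p ` J) (f p a)"
      using M(2) N(2) by (simp_all add: lo_image hi_image)
    \<comment> \<open>Every index above this one has \<open>p\<close> in its finite set, so its
      point obeys its bounds for \<open>p\<close>.\<close>
    obtain B b where "(\<phi>0, {p}, B, b) \<in> J" using extend[of \<phi>0 "{p}" UNIV] \<phi>0 by auto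
    from eventually_tails_above[OF net this]
    show "\<forall>\<^sub>F j in tails J s. lo p j \<le> f p (y j) \<and> f p (y j) \<le> hi p j"
      by eventually_elim (auto simp: J_def s_def lo_def hi_def y_def)
  qed
  note O1 = this
  have "uO1_converges J s y a"
    unfolding uO1_converges_def
  proof (intro allI impI)
    fix u v :: 'a assume "u \<le> v"
    then have "f (u, v) = trunc u v" by (simp add: f_def inf_absorb1)
    with O1[of "(u, v)"] show "O1_converges J s (\<lambda>i. trunc u v (y i)) (trunc u v a)" by simp
  qed
  moreover have "\<forall>\<^sub>F i in tails I r. P (x i)" if "\<forall>\<^sub>F j in tails J s. P (y j)" for P
  proof -
    obtain \<phi> F A b where J: "(\<phi>, F, A, b) \<in> J" and P: "\<And>j. j \<in> J \<Longrightarrow> s (\<phi>, F, A, b) j \<Longrightarrow> P (y j)"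
    proof -
      obtain j where "j \<in> J" "\<And>k. k \<in> J \<Longrightarrow> s j k \<Longrightarrow> P (y k)"
        using \<open>eventually _ (tails J s)\<close> unfolding eventually_tails[OF net] by blast
      then show ?thesis using that by (cases j) blast
    qed
    \<comment> \<open>Swapping \<open>b\<close> for \<open>c\<close> gives an index still above the
      chosen one, so \<open>P\<close> holds on all of \<open>A\<close>.\<close>
    have "P c" if "c \<in> A" for c
      using P[of "(\<phi>, F, A, c)"] J that by (auto simp: J_def s_def y_def)
    moreover have "\<forall>\<^sub>F i in tails I r. x i \<in> A" using J by (simp add: J_def)
    ultimately show ?thesis by (auto elim: eventually_mono)
  qed
  ultimately show thesis by (rule that[OF net])
qed

lemma uO2_implies_uO1_implies_convergence:
  "uO2_implies_convergence TYPE('i) T \<Longrightarrow> uO1_implies_convergence TYPE('i) T"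
  unfolding uO1_implies_convergence_def uO2_implies_convergence_def
  by (blast intro: uO1_converges_imp_uO2_converges)

lemma uO1_implies_uO2_implies_convergence:
  fixes T :: "'a::lattice topology"
  assumes "uO1_implies_convergence TYPE('a universal_index) T"
  shows "uO2_implies_convergence TYPE('i) T"
  unfolding uO2_implies_convergence_def
proof (intro allI impI, elim conjE)
  fix I :: "'i set" and r x and a :: 'a
  assume "net_index I r" "uO2_converges I r x a"
  then obtain J :: "'a universal_index set" and s y where
    "net_index J s" "uO1_converges J s y a"
    and ev: "\<And>P. \<forall>\<^sub>F j in tails J s. P (y j) \<Longrightarrow> \<forall>\<^sub>F i in tails I r. P (x i)"
    by (rule uO2_converges_refine) (rule that)
  with assms have "limitin T y a (tails J s)"
    unfolding uO1_implies_convergence_def by blast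
  then show "limitin T x a (tails I r)"
    unfolding limitin_def using ev[of "\<lambda>b. b \<in> _"] by simp
qed

(* The first conjunct is the equivalence, for nets indexed in the universal index type. The other
   two say that this covers all nets: either condition for that index type yields the
   condition for nets indexed in an arbitrary type 'i. *)
theorem corollary2p6:
  fixes T :: "'a::lattice topology"
  assumes "topspace T = UNIV"
  shows "(uO1_implies_convergence TYPE('a universal_index) T \<longleftrightarrow>
            uO2_implies_convergence TYPE('a universal_index) T) \<and>
         (uO1_implies_convergence TYPE('a universal_index) T \<longrightarrow>
            uO1_implies_convergence TYPE('i) T) \<and>
         (uO2_implies_convergence TYPE('a universal_index) T \<longrightarrow>
            uO2_implies_convergence TYPE('i) T)"
  \<comment> \<open>Passing from the first condition to the second changes the index type; the last
    two conjuncts compose this with the converse, which keeps it.\<close>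
  by (blast intro: uO1_implies_uO2_implies_convergence uO2_implies_uO1_implies_convergence)

end
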